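(* The function $\lambda(k)=(\mu(k^2))^2$, $k\ge 1$, is algebraic on $[1,\infty)$; therefore the function $\mu$ is also algebraic on $[1,\infty)$.
   Context: Definition of $\mu$. For real $r\ge 1$, let $C_1$ and $C_r$ be circles of radii $1$ and $r$, respectively, which are (externally) tangent to each other and both tangent to a common line $L$, lying on the same side of $L$. In coordinates one may take $L=\{y=0\}$, $C_1$ with center $(0,1)$ and $C_r$ with center $(2\sqrt r,r)$. Consider the closed bounded curvilinear triangular region enclosed by $C_1$, $C_r$ and $L$ (bounded by the segment of $L$ between the two points of tangency with $L$, and by the arcs of $C_1$ and $C_r$ joining these points to the point of tangency of the two circles). Among all squares (of arbitrary orientation) contained in this region and touching each of $C_1$, $C_r$ and $L$, $\mu(r)$ denotes the minimal possible side length. Known characterization of $\mu$ recalled from earlier work (Holly and Krumm, 2021): for each $r\ge 1$, $\mu(r)$ is the minimum value on the interval $(1-1/\sqrt2,\,1)$ of the function $$z_r(x)=\sqrt{x^{2}+\Bigl(r-x-\sqrt{r^{2}-\bigl(2\sqrt r-x-\sqrt{2x-x^{2}}\bigr)^{2}}\Bigr)^{2}}.$$ A real-valued function $f$ defined on an interval $I\subset\mathbb{R}$ is called algebraic if there exists a nonzero polynomial $P(x,y)\in\mathbb{R}[x,y]$ such that $P(c,f(c))=0$ for all $c\in I$. *)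

theory Defs
  imports "HOL-Analysis.Analysis" "HOL-Computational_Algebra.Polynomial"
begin

text \<open>The plane is identified with the type of complex numbers.\<close>

definition base_line :: "complex set" where
  "base_line = {z. Im z = 0}"

definition center1 :: complex where
  "center1 = Complex 0 1"

definition center2 :: "real \<Rightarrow> complex" where
  "center2 r = Complex (2 * sqrt r) r"

definition circle1 :: "complex set" where
  "circle1 = sphere center1 1"

definition circle2 :: "real \<Rightarrow> complex set" where
  "circle2 r = sphere (center2 r) r"

text \<open>The closed curvilinear triangle enclosed by the two circles and the line. The circles touch
  the line at the abscissae \<open>0\<close> and \<open>2 * sqrt r\<close>, and they touch each other at height
  \<open>2 * r / (r + 1)\<close>. On every horizontal line between height \<open>0\<close> and that height, the points with
  abscissa between \<open>0\<close> and \<open>2 * sqrt r\<close> lying outside both open discs form precisely the segment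
  from the one arc to the other; the bound on the height cuts off the unbounded part above the
  point of tangency.\<close>

definition region :: "real \<Rightarrow> complex set" where
  "region r = {z. 0 \<le> Re z \<and> Re z \<le> 2 * sqrt r \<and> 0 \<le> Im z \<and> Im z \<le> 2 * r / (r + 1) \<and>
                  z \<notin> ball center1 1 \<and> z \<notin> ball (center2 r) r}"

text \<open>The (filled) square with a vertex \<open>p\<close> and side vector \<open>v\<close>. Multiplication by \<open>\<i>\<close> is the
  rotation by a right angle, so that every square has this form, with side length \<open>norm v\<close>.\<close>

definition square :: "complex \<Rightarrow> complex \<Rightarrow> complex set" where
  "square p v = convex hull {p, p + v, p + v + \<i> * v, p + \<i> * v}"

definition admissible_side :: "real \<Rightarrow> real \<Rightarrow> bool" where
  "admissible_side r s \<longleftrightarrow>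
     (\<exists>p v. v \<noteq> 0 \<and> s = norm v \<and> square p v \<subseteq> region r \<and>
            square p v \<inter> circle1 \<noteq> {} \<and> square p v \<inter> circle2 r \<noteq> {} \<and>
            square p v \<inter> base_line \<noteq> {})"

definition mu :: "real \<Rightarrow> real" where
  "mu r = (LEAST s. admissible_side r s)"

text \<open>A bivariate polynomial \<open>P(x,y)\<close> is a polynomial in \<open>y\<close> whose coefficients are polynomials
  in \<open>x\<close>; evaluating it at the constant polynomial \<open>[:y:]\<close> and then at \<open>x\<close> yields \<open>P(x,y)\<close>.\<close>

definition eval2 :: "real poly poly \<Rightarrow> real \<Rightarrow> real \<Rightarrow> real" where
  "eval2 P x y = poly (poly P [:y:]) x"

definition algebraic_on :: "real set \<Rightarrow> (real \<Rightarrow> real) \<Rightarrow> bool" where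
  "algebraic_on I f \<longleftrightarrow> (\<exists>P. P \<noteq> 0 \<and> (\<forall>c\<in>I. eval2 P c (f c) = 0))"

end

theory Submission
  imports Defs
begin

text \<open>
  The value \<open>mu r\<close> is described by a first-order formula over the real field: a square is a point
  and a vector, its points are the points \<open>p + z * v\<close> with \<open>z\<close> in the unit box, and the region, the
  circles and the line are cut out by polynomial conditions in the coordinates, in \<open>r\<close> and in
  \<open>sqrt r\<close>. By Tarski and Seidenberg, a first-order formula in two free variables \<open>x\<close>, \<open>y\<close> defines a
  set which depends only on the signs of finitely many polynomials \<open>g(x,y)\<close>. If such a set contains
  at most one \<open>y\<close> for each \<open>x\<close>, then one of the nonzero \<open>g\<close> vanishes at each of its points, because
  otherwise all signs would stay the same when \<open>y\<close> moves a little. So the product of the nonzero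
  \<open>g\<close> is a polynomial that witnesses algebraicity
  (\<open>definable_function_algebraic\<close>).

  The elimination of one real quantifier (\<open>sign_definable_ex\<close>) follows Cohen and Hormander. A point
  of the parameter space is a ring homomorphism \<open>h\<close> from a domain \<open>'a\<close> to the reals, and adjoining a
  real variable passes from \<open>'a\<close> to \<open>'a poly\<close>; iterating this gives any number of variables. For a
  finite set \<open>Q\<close> of polynomials over \<open>'a\<close>, two parameter points \<open>h\<close>, \<open>h'\<close> have the same sign diagram if
  an increasing bijection of the line carries the signs of the specialisations at \<open>h\<close> to those at
  \<open>h'\<close>. Equality of diagrams is forced by equality of the signs of finitely many
  elements of \<open>'a\<close> (\<open>diagram_controlled_finite\<close>). This is shown by adding polynomials in the order of their degrees:
  the sign diagram of \<open>p\<close> is determined once its derivative and its remainders modulo the other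
  polynomials are under control (\<open>extend_sign_diagram\<close>), and those have smaller degree.
\<close>

section \<open>Signs of real polynomials along an increasing bijection\<close>

lemma sgn_poly_at_top:
  fixes p :: "real poly"
  assumes "p \<noteq> 0"
  obtains N where "\<And>x. x \<ge> N \<Longrightarrow> sgn (poly p x) = sgn (lead_coeff p)"
proof -
  have pos: "\<exists>N. \<forall>x\<ge>N. poly q x > 0" if "lead_coeff q > 0" for q :: "real poly"
    using poly_pinfty_gt_lc[OF that] that by (meson less_le_trans)
  show ?thesis
  proof (cases "lead_coeff p > 0")
    case True
    then obtain N where "\<forall>x\<ge>N. poly p x > 0" using pos by blast
    with True show ?thesis by (intro that[of N]) auto
  next
    case False
    with assms have "lead_coeff p < 0" by (meson leading_coeff_0_iff linorder_neqE_linordered_idom)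
    moreover from this obtain N where "\<forall>x\<ge>N. poly (- p) x > 0" using pos[of "- p"] by auto
    ultimately show ?thesis by (intro that[of N]) auto
  qed
qed

lemma sgn_poly_at_bot:
  fixes p :: "real poly"
  assumes "p \<noteq> 0"
  obtains N where "\<And>x. x \<le> N \<Longrightarrow> sgn (poly p x) = sgn ((- 1) ^ degree p * lead_coeff p)"
proof -
  let ?q = "pcompose p [:0, -1:]"
  have "lead_coeff ?q = (- 1) ^ degree p * lead_coeff p"
    by (subst lead_coeff_comp) auto
  moreover have "?q \<noteq> 0" using assms by (simp add: pcompose_eq_0_iff)
  ultimately obtain N where N: "\<And>x. x \<ge> N \<Longrightarrow> sgn (poly ?q x) = sgn ((- 1) ^ degree p * lead_coeff p)"
    using sgn_poly_at_top[of ?q] by metis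
  show ?thesis
    using N[of "- x" for x] by (intro that[of "- N"]) (simp add: poly_pcompose)
qed

lemma sgn_poly_eq_if_no_root:
  fixes p :: "real poly"
  assumes "\<And>x. min u v \<le> x \<Longrightarrow> x \<le> max u v \<Longrightarrow> poly p x \<noteq> 0"
  shows "sgn (poly p u) = sgn (poly p v)"
proof -
  have *: "sgn (poly p a) = sgn (poly p b)"
    if "a < b" "\<And>x. a \<le> x \<Longrightarrow> x \<le> b \<Longrightarrow> poly p x \<noteq> 0" for a b
  proof -
    have "\<not> poly p a * poly p b < 0" using poly_IVT[OF that(1), of p] that(2) by force
    moreover have "poly p a \<noteq> 0" "poly p b \<noteq> 0" using that by auto
    ultimately show ?thesis
      by (metis mult_neg_pos mult_pos_neg linorder_neqE_linordered_idom sgn_neg sgn_pos)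
  qed
  show ?thesis
  proof (cases u v rule: linorder_cases)
    case less
    then show ?thesis by (intro * assms) auto
  next
    case greater
    then show ?thesis by (intro *[symmetric] assms) auto
  qed simp
qed

text \<open>
  A finite increasing correspondence is all that has to be constructed by hand: it is continued
  linearly to the right of its largest point.
\<close>

lemma extend_strict_mono_on_finite:
  fixes g :: "real \<Rightarrow> real"
  assumes "finite T" "strict_mono_on T g"
  shows "\<exists>\<psi>. strict_mono \<psi> \<and> surj \<psi> \<and> (\<forall>t\<in>T. \<psi> t = g t)"
  using assms
proof (induction T rule: finite_linorder_max_induct)
  case empty
  show ?case by (rule exI[of _ id]) (auto simp: strict_mono_def)
next
  case (insert m T)
  show ?case
  proof (cases "T = {}")
    case True
    have "surj (\<lambda>t. t + (g m - m))" by (rule surjI[of _ "\<lambda>t. t - (g m - m)"]) simp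
    with True show ?thesis
      by (intro exI[of _ "\<lambda>t. t + (g m - m)"]) (auto simp: strict_mono_def)
  next
    case False
    obtain \<psi> where \<psi>: "strict_mono \<psi>" "surj \<psi>" "\<forall>t\<in>T. \<psi> t = g t"
      using insert by (auto simp: strict_mono_on_def)
    define k where "k = Max T"
    have k: "k \<in> T" "k < m" using insert False by (auto simp: k_def)
    have gk: "g k < g m" using insert.prems k by (auto simp: strict_mono_on_def)
    define c where "c = (g m - g k) / (m - k)"
    have c: "c > 0" using gk k by (simp add: c_def)
    define \<psi>' where "\<psi>' t = (if t \<le> k then \<psi> t else \<psi> k + (t - k) * c)" for t
    have "strict_mono \<psi>'"
    proof (rule strict_monoI)
      fix x y :: real assume "x < y"
      consider "y \<le> k" | "x \<le> k" "k < y" | "k < x" by linarith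
      then show "\<psi>' x < \<psi>' y"
      proof cases
        case 1 then show ?thesis using \<open>x < y\<close> \<psi>(1) by (auto simp: \<psi>'_def strict_mono_def)
      next
        case 2
        then have "\<psi> x \<le> \<psi> k" using \<psi>(1) by (simp add: strict_mono_less_eq)
        moreover have "(y - k) * c > 0" using c 2 by simp
        ultimately show ?thesis using 2 by (auto simp: \<psi>'_def)
      next
        case 3 then show ?thesis using \<open>x < y\<close> c by (auto simp: \<psi>'_def)
      qed
    qed
    moreover have "surj \<psi>'"
    proof (rule surj_def[THEN iffD2], intro allI)
      fix y
      show "\<exists>x. y = \<psi>' x"
      proof (cases "y \<le> \<psi> k")
        case True
        obtain x where "y = \<psi> x" using \<psi>(2) by (auto simp: surj_def)
        with True \<psi>(1) show ?thesis by (intro exI[of _ x]) (auto simp: \<psi>'_def strict_mono_less_eq)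
      next
        case False
        then show ?thesis using c by (intro exI[of _ "k + (y - \<psi> k) / c"]) (auto simp: \<psi>'_def field_simps)
      qed
    qed
    moreover have "\<forall>t\<in>insert m T. \<psi>' t = g t"
    proof
      fix t assume "t \<in> insert m T"
      then consider "t = m" | "t \<in> T" "t \<le> k" using insert by (auto simp: k_def)
      then show "\<psi>' t = g t" using k \<psi>(3) by cases (auto simp: \<psi>'_def c_def)
    qed
    ultimately show ?thesis by blast
  qed
qed

text \<open>
  If \<open>Z\<close> contains all critical points of \<open>p\<close>, then \<open>p\<close> is strictly monotone between two neighbours
  \<open>a < b\<close> in \<open>Z\<close>. A root of \<open>p\<close> between them thus makes \<open>p\<close> change sign from \<open>a\<close> to \<open>b\<close>, hence \<open>p'\<close>
  from \<open>\<phi> a\<close> to \<open>\<phi> b\<close>, and \<open>p'\<close> has a root there as well.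
\<close>

lemma matching_root:
  fixes p p' :: "real poly"
  assumes "finite Z" "strict_mono \<phi>"
    and sgn_Z: "\<And>z. z \<in> Z \<Longrightarrow> sgn (poly p z) = sgn (poly p' (\<phi> z))"
    and crit: "\<And>t. poly (pderiv p) t = 0 \<Longrightarrow> t \<in> Z"
    and lo: "l \<in> Z" "l < \<rho>" and hi: "u \<in> Z" "\<rho> < u"
    and root: "poly p \<rho> = 0" "\<rho> \<notin> Z"
  obtains \<rho>' where "poly p' \<rho>' = 0"
    "\<And>z. z \<in> Z \<Longrightarrow> z < \<rho> \<longleftrightarrow> \<phi> z < \<rho>'" "\<And>z. z \<in> Z \<Longrightarrow> \<rho> < z \<longleftrightarrow> \<rho>' < \<phi> z"
proof -
  define a where "a = Max {z\<in>Z. z < \<rho>}"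
  define b where "b = Min {z\<in>Z. \<rho> < z}"
  have "a \<in> {z\<in>Z. z < \<rho>}" unfolding a_def by (rule Max_in) (use assms in auto)
  then have a: "a \<in> Z" "a < \<rho>" by auto
  have "b \<in> {z\<in>Z. \<rho> < z}" unfolding b_def by (rule Min_in) (use assms in auto)
  then have b: "b \<in> Z" "\<rho> < b" by auto
  have below: "z \<le> a" if "z \<in> Z" "z < \<rho>" for z unfolding a_def using that assms(1) by auto
  have above: "b \<le> z" if "z \<in> Z" "\<rho> < z" for z unfolding b_def using that assms(1) by auto
  have gap: "z \<notin> Z" if "a < z" "z < b" for z
    using below[of z] above[of z] that root(2) by (cases z \<rho> rule: linorder_cases) auto
  obtain x where x: "a < x" "x < \<rho>" "- poly p a = (\<rho> - a) * poly (pderiv p) x"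
    using poly_MVT[OF a(2), of p] root by auto
  obtain y where y: "\<rho> < y" "y < b" "poly p b = (b - \<rho>) * poly (pderiv p) y"
    using poly_MVT[OF b(2), of p] root by auto
  have nz: "poly (pderiv p) t \<noteq> 0" if "x \<le> t" "t \<le> y" for t
    using crit[of t] gap[of t] x y that by auto
  have "sgn (poly (pderiv p) x) = sgn (poly (pderiv p) y)"
    by (rule sgn_poly_eq_if_no_root) (use nz x y in auto)
  moreover have "sgn (poly p a) = - sgn (poly (pderiv p) x)"
  proof -
    have "sgn (- poly p a) = sgn (poly (pderiv p) x)" unfolding x(3) using a by (simp add: sgn_mult)
    then show ?thesis by (simp add: sgn_minus)
  qed
  moreover have "sgn (poly p b) = sgn (poly (pderiv p) y)" unfolding y(3) using b by (simp add: sgn_mult)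
  ultimately have "sgn (poly p' (\<phi> a)) = - sgn (poly p' (\<phi> b))" "poly p' (\<phi> b) \<noteq> 0"
    using sgn_Z[OF a(1)] sgn_Z[OF b(1)] nz[of y] x(1,2) y(1,2)
    by (metis less_imp_le less_trans minus_minus sgn_zero_iff neg_equal_0_iff_equal order_refl)+
  then have "poly p' (\<phi> a) * poly p' (\<phi> b) < 0"
    by (auto simp: sgn_if mult_less_0_iff split: if_splits)
  moreover have "\<phi> a < \<phi> b" using assms(2) a b by (auto simp: strict_mono_def)
  ultimately obtain \<rho>' where r: "\<phi> a < \<rho>'" "\<rho>' < \<phi> b" "poly p' \<rho>' = 0"
    using poly_IVT by blast
  have 1: "\<phi> z < \<rho>'" if "z \<in> Z" "z < \<rho>" for z
    using below[OF that] r strict_mono_less_eq[OF assms(2), of z a] by simp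
  have 2: "\<rho>' < \<phi> z" if "z \<in> Z" "\<rho> < z" for z
    using above[OF that] r strict_mono_less_eq[OF assms(2), of b z] by simp
  have 3: "z < \<rho> \<or> \<rho> < z" if "z \<in> Z" for z using that root(2) by (cases z \<rho> rule: linorder_cases) auto
  show ?thesis
  proof (rule that[OF r(3)])
    fix z assume z: "z \<in> Z"
    show "z < \<rho> \<longleftrightarrow> \<phi> z < \<rho>'" using 1[OF z] 2[OF z] 3[OF z] by linarith
    show "\<rho> < z \<longleftrightarrow> \<rho>' < \<phi> z" using 1[OF z] 2[OF z] 3[OF z] by linarith
  qed
qed

text \<open>
  The inductive step of the Cohen-Hormander method, for fixed real polynomials. The bijection \<open>\<phi>\<close>
  matches the signs of a finite family containing the derivatives of \<open>p\<close> and \<open>p'\<close>, and at the roots of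
  the family it also matches the signs of \<open>p\<close> and \<open>p'\<close>. Then \<open>\<phi>\<close> can be modified between
  the roots of the family so that it matches \<open>p\<close> with \<open>p'\<close> everywhere: between consecutive
  roots both polynomials are monotone, so there is at most one root, and the signs at the two ends
  decide whether it exists. At the two unbounded ends these signs come from the degree and from the
  leading coefficient.
\<close>

lemma extend_sign_diagram:
  fixes f f' :: "'i \<Rightarrow> real poly" and p p' :: "real poly"
  assumes "finite I" and phi: "strict_mono \<phi>" "surj \<phi>"
    and sgn_I: "\<And>i t. i \<in> I \<Longrightarrow> sgn (poly (f i) t) = sgn (poly (f' i) (\<phi> t))"
    and d: "d \<in> I" "f d = pderiv p" "f' d = pderiv p'"
    and deg: "degree p > 0" "degree p' = degree p" and lc: "sgn (lead_coeff p) = sgn (lead_coeff p')"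
    and sgn_roots: "\<And>i t. i \<in> I \<Longrightarrow> f i \<noteq> 0 \<Longrightarrow> poly (f i) t = 0 \<Longrightarrow> sgn (poly p t) = sgn (poly p' (\<phi> t))"
  obtains \<psi> where "strict_mono \<psi>" "surj \<psi>"
    "\<And>i t. i \<in> I \<Longrightarrow> sgn (poly (f i) t) = sgn (poly (f' i) (\<psi> t))"
    "\<And>t. sgn (poly p t) = sgn (poly p' (\<psi> t))"
proof -
  define \<theta> where "\<theta> = inv \<phi>"
  have phi_theta [simp]: "\<phi> (\<theta> y) = y" for y unfolding \<theta>_def using phi(2) by (rule surj_f_inv_f)
  have theta_phi [simp]: "\<theta> (\<phi> y) = y" for y
    unfolding \<theta>_def by (rule inv_f_f[OF strict_mono_imp_inj_on[OF phi(1)]])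
  have phi_less [simp]: "\<phi> x < \<phi> y \<longleftrightarrow> x < y" for x y using phi(1) by (rule strict_mono_less)
  have theta_less: "\<theta> x < y \<longleftrightarrow> x < \<phi> y" for x y using phi_less[of "\<theta> x" y] by simp
  have less_theta: "x < \<theta> y \<longleftrightarrow> \<phi> x < y" for x y using phi_less[of x "\<theta> y"] by simp
  have theta_mono: "strict_mono \<theta>" by (rule strict_monoI) (simp add: theta_less)
  have nz: "f i \<noteq> 0 \<longleftrightarrow> f' i \<noteq> 0" if "i \<in> I" for i
  proof -
    have "(\<forall>t. poly (f i) t = 0) \<longleftrightarrow> (\<forall>t. poly (f' i) (\<phi> t) = 0)"
      using sgn_I[OF that] by (metis sgn_zero_iff)
    also have "\<dots> \<longleftrightarrow> (\<forall>t. poly (f' i) t = 0)" by (metis phi_theta)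
    finally show ?thesis by (simp add: poly_all_0_iff_0)
  qed
  have p0: "p \<noteq> 0" "p' \<noteq> 0" "pderiv p \<noteq> 0" "pderiv p' \<noteq> 0"
    using deg by (auto simp: pderiv_eq_0_iff)
  define sb where "sb = sgn ((- 1) ^ degree p * lead_coeff p)"
  obtain N1 where N1: "\<And>x. x \<le> N1 \<Longrightarrow> sgn (poly p x) = sb"
    using sgn_poly_at_bot[OF p0(1)] unfolding sb_def by metis
  obtain N2 where N2: "\<And>x. x \<le> N2 \<Longrightarrow> sgn (poly p' x) = sb"
    using sgn_poly_at_bot[OF p0(2)] unfolding sb_def using deg lc by (metis sgn_mult)
  define st where "st = sgn (lead_coeff p)"
  obtain M1 where M1: "\<And>x. x \<ge> M1 \<Longrightarrow> sgn (poly p x) = st"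
    using sgn_poly_at_top[OF p0(1)] unfolding st_def by metis
  obtain M2 where M2: "\<And>x. x \<ge> M2 \<Longrightarrow> sgn (poly p' x) = st"
    using sgn_poly_at_top[OF p0(2)] unfolding st_def using lc by metis
  have s0: "sb \<noteq> 0" "st \<noteq> 0" unfolding sb_def st_def using p0 by (auto simp: sgn_zero_iff)
  \<comment> \<open>Beyond the auxiliary points \<open>l\<close> and \<open>u\<close> all signs are those at infinity, so that every
    root of \<open>p\<close> lies between two points of the finite set \<open>Z\<close> below.\<close>
  define l where "l = min N1 (\<theta> N2)"
  define u where "u = max M1 (\<theta> M2)"
  have l1: "sgn (poly p x) = sb" if "x \<le> l" for x using N1 that by (simp add: l_def)
  have u1: "sgn (poly p x) = st" if "x \<ge> u" for x using M1 that by (simp add: u_def)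
  have l2: "sgn (poly p' x) = sb" if "x \<le> \<phi> l" for x
  proof -
    have "\<theta> x \<le> \<theta> N2" using that less_theta[of l x] by (simp add: l_def not_less)
    then show ?thesis using N2[of x] strict_mono_less_eq[OF theta_mono] by blast
  qed
  have u2: "sgn (poly p' x) = st" if "x \<ge> \<phi> u" for x
  proof -
    have "\<theta> M2 \<le> \<theta> x" using that theta_less[of x u] by (simp add: u_def not_less)
    then show ?thesis using M2[of x] strict_mono_less_eq[OF theta_mono] by blast
  qed
  define Z where "Z = {t. \<exists>i\<in>I. f i \<noteq> 0 \<and> poly (f i) t = 0} \<union> {l, u}"
  have "{t. \<exists>i\<in>I. f i \<noteq> 0 \<and> poly (f i) t = 0} = (\<Union>i\<in>{i\<in>I. f i \<noteq> 0}. {t. poly (f i) t = 0})" by auto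
  then have finZ: "finite Z" unfolding Z_def using \<open>finite I\<close> by (auto intro: poly_roots_finite)
  have lu: "l \<in> Z" "u \<in> Z" by (auto simp: Z_def)
  have sgn_Z: "sgn (poly p z) = sgn (poly p' (\<phi> z))" if "z \<in> Z" for z
    using that sgn_roots l1[of l] l2[of "\<phi> l"] u1[of u] u2[of "\<phi> u"] by (auto simp: Z_def)
  have crit: "t \<in> Z" if "poly (pderiv p) t = 0" for t
    using that d(1,2) p0(3) unfolding Z_def by (intro UnI1 CollectI bexI[of _ d]) auto
  have root': "\<theta> y \<in> Z" if "i \<in> I" "f' i \<noteq> 0" "poly (f' i) y = 0" for i y
    using sgn_I[OF that(1), of "\<theta> y"] that nz[OF that(1)] unfolding Z_def by (auto simp: sgn_zero_iff)
  have crit': "t \<in> \<phi> ` Z" if "poly (pderiv p') t = 0" for t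
    using root'[OF d(1), of t] that d p0 by (metis phi_theta imageI)
  have bd: "l < \<rho>" "\<rho> < u" if "poly p \<rho> = 0" for \<rho>
    using l1[of \<rho>] u1[of \<rho>] s0 that by (force simp: not_less[symmetric])+
  have bd': "\<phi> l < \<rho>" "\<rho> < \<phi> u" if "poly p' \<rho> = 0" for \<rho>
    using l2[of \<rho>] u2[of \<rho>] s0 that by (force simp: not_less[symmetric])+
  \<comment> \<open>Two roots correspond if they lie in corresponding gaps of \<open>Z\<close> and \<open>\<phi> ` Z\<close>.\<close>
  define R where "R \<rho> \<rho>' \<longleftrightarrow> poly p' \<rho>' = 0 \<and>
      (\<forall>z\<in>Z. (z < \<rho> \<longleftrightarrow> \<phi> z < \<rho>') \<and> (\<rho> < z \<longleftrightarrow> \<rho>' < \<phi> z))" for \<rho> \<rho>'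
  have R_ex: "\<exists>\<rho>'. R \<rho> \<rho>'" if r: "poly p \<rho> = 0" "\<rho> \<notin> Z" for \<rho>
    using matching_root[OF finZ phi(1) sgn_Z crit lu(1) bd(1)[OF r(1)] lu(2) bd(2)[OF r(1)] r]
    unfolding R_def by metis
  have R_ex': "\<exists>\<rho>. poly p \<rho> = 0 \<and> \<rho> \<notin> Z \<and> R \<rho> \<rho>'" if r: "poly p' \<rho>' = 0" "\<rho>' \<notin> \<phi> ` Z" for \<rho>'
  proof -
    obtain \<rho> where rho: "poly p \<rho> = 0"
      "\<And>z. z \<in> \<phi> ` Z \<Longrightarrow> z < \<rho>' \<longleftrightarrow> \<theta> z < \<rho>" "\<And>z. z \<in> \<phi> ` Z \<Longrightarrow> \<rho>' < z \<longleftrightarrow> \<rho> < \<theta> z"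
    proof (rule matching_root[of "\<phi> ` Z" \<theta> p' p "\<phi> l" \<rho>' "\<phi> u"])
      fix z assume "z \<in> \<phi> ` Z"
      then show "sgn (poly p' z) = sgn (poly p (\<theta> z))" using sgn_Z by auto
    qed (use finZ theta_mono crit' lu bd'[OF r(1)] r in auto)
    have "R \<rho> \<rho>'" using r(1) rho(2,3) unfolding R_def by auto
    moreover have "\<rho> \<notin> Z"
    proof
      assume "\<rho> \<in> Z"
      then have "\<rho>' = \<phi> \<rho>" using rho(2,3)[of "\<phi> \<rho>"] by (metis imageI less_irrefl linorder_neqE theta_phi)
      with \<open>\<rho> \<in> Z\<close> r(2) show False by auto
    qed
    ultimately show ?thesis using rho(1) by blast
  qed
  \<comment> \<open>Different roots of \<open>p\<close> lie in different gaps, by Rolle; the same for \<open>p'\<close> gives uniqueness.\<close>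
  have R_mono: "\<rho>1' < \<rho>2'" if R: "R \<rho>1 \<rho>1'" "R \<rho>2 \<rho>2'" and r: "poly p \<rho>1 = 0" "poly p \<rho>2 = 0" "\<rho>1 < \<rho>2"
    for \<rho>1 \<rho>2 \<rho>1' \<rho>2'
  proof -
    obtain z where z: "\<rho>1 < z" "z < \<rho>2" "poly (pderiv p) z = 0"
      using poly_MVT[OF r(3), of p] r by auto
    then show ?thesis using R crit[OF z(3)] unfolding R_def by (meson less_trans)
  qed
  have R_uniq: "\<rho>1' = \<rho>2'" if R: "R \<rho> \<rho>1'" "R \<rho> \<rho>2'" for \<rho> \<rho>1' \<rho>2'
  proof -
    have "\<not> x < y" if R': "R \<rho> x" "R \<rho> y" for x y
    proof
      assume "x < y"
      then obtain z where z: "x < z" "z < y" "poly (pderiv p') z = 0"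
        using poly_MVT[OF \<open>x < y\<close>, of p'] R' unfolding R_def by auto
      then obtain w where "w \<in> Z" "z = \<phi> w" using crit' by blast
      then have "\<rho> < w" "w < \<rho>" using z(1,2) R' unfolding R_def by auto
      then show False by simp
    qed
    then show ?thesis using R by (metis linorder_neqE)
  qed
  define g where "g t = (if t \<in> Z then \<phi> t else (SOME y. R t y))" for t
  have gR: "R t (g t)" if "poly p t = 0" "t \<notin> Z" for t
    using someI_ex[OF R_ex[OF that]] that by (simp add: g_def)
  define T where "T = Z \<union> {t. poly p t = 0}"
  have finT: "finite T" unfolding T_def using finZ p0 by (auto intro: poly_roots_finite)
  have "strict_mono_on T g"
  proof (rule strict_mono_onI)
    fix x y assume xy: "x \<in> T" "y \<in> T" "x < y"
    have Z: "g x = \<phi> x" "x \<in> Z" if "\<not> (poly p x = 0 \<and> x \<notin> Z)" "x \<in> T" for x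
      using that by (auto simp: T_def g_def)
    consider "x \<in> Z" "y \<in> Z" | "x \<in> Z" "y \<notin> Z" "poly p y = 0" | "x \<notin> Z" "y \<in> Z" "poly p x = 0"
      | "x \<notin> Z" "y \<notin> Z" "poly p x = 0" "poly p y = 0" using xy by (auto simp: T_def)
    then show "g x < g y"
    proof cases
      case 1 then show ?thesis using xy by (simp add: g_def)
    next
      case 2 then show ?thesis using xy gR[of y] by (auto simp: g_def R_def)
    next
      case 3 then show ?thesis using xy gR[of x] by (auto simp: g_def R_def)
    next
      case 4 then show ?thesis using R_mono[OF gR gR] xy by auto
    qed
  qed
  then obtain \<psi> where psi: "strict_mono \<psi>" "surj \<psi>" and psi_T: "\<And>t. t \<in> T \<Longrightarrow> \<psi> t = g t"
    using extend_strict_mono_on_finite[OF finT] by blast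
  have psi_less [simp]: "\<psi> x < \<psi> y \<longleftrightarrow> x < y" for x y using psi(1) by (rule strict_mono_less)
  have psi_Z: "\<psi> z = \<phi> z" if "z \<in> Z" for z using that psi_T[of z] by (simp add: T_def g_def)
  \<comment> \<open>On the family, \<open>\<psi>\<close> is as good as \<open>\<phi>\<close>: the two agree on \<open>Z\<close>, so no root of the family
    separates \<open>\<phi> t\<close> from \<open>\<psi> t\<close>.\<close>
  have I': "sgn (poly (f i) t) = sgn (poly (f' i) (\<psi> t))" if i: "i \<in> I" for i t
  proof (cases "t \<in> Z \<or> f i = 0")
    case True
    then show ?thesis using sgn_I[OF i, of t] psi_Z nz[OF i] by auto
  next
    case False
    have "sgn (poly (f' i) (\<phi> t)) = sgn (poly (f' i) (\<psi> t))"
    proof (rule sgn_poly_eq_if_no_root, rule notI)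
      fix y assume y: "min (\<phi> t) (\<psi> t) \<le> y" "y \<le> max (\<phi> t) (\<psi> t)" "poly (f' i) y = 0"
      define z where "z = \<theta> y"
      have z: "z \<in> Z" "y = \<phi> z" using root'[OF i _ y(3)] nz[OF i] False by (auto simp: z_def)
      show False
      proof (cases z t rule: linorder_cases)
        case less
        then have "\<phi> z < \<phi> t" "\<phi> z < \<psi> t" using psi_Z[OF z(1)] psi_less[of z t] by auto
        then show False using y(1,2) z(2) by linarith
      next
        case greater
        then have "\<phi> t < \<phi> z" "\<psi> t < \<phi> z" using psi_Z[OF z(1)] psi_less[of t z] by auto
        then show False using y(1,2) z(2) by linarith
      qed (use z False in auto)
    qed
    then show ?thesis using sgn_I[OF i] by simp
  qed
  have psi_roots: "poly p' (\<psi> t) = 0 \<longleftrightarrow> poly p t = 0" for t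
  proof
    assume r: "poly p t = 0"
    show "poly p' (\<psi> t) = 0"
    proof (cases "t \<in> Z")
      case True then show ?thesis using sgn_Z[OF True] psi_Z[OF True] r by (simp add: sgn_zero_iff)
    next
      case False then show ?thesis using gR[OF r False] psi_T[of t] r by (simp add: T_def R_def)
    qed
  next
    assume r: "poly p' (\<psi> t) = 0"
    show "poly p t = 0"
    proof (cases "\<psi> t \<in> \<phi> ` Z")
      case True
      then obtain z where z: "z \<in> Z" "\<psi> t = \<psi> z" using psi_Z by auto
      then have "t = z" using strict_mono_eq[OF psi(1)] by blast
      then show ?thesis using sgn_Z[OF z(1)] r psi_Z[OF z(1)] by (simp add: sgn_zero_iff)
    next
      case False
      then obtain \<rho> where rho: "poly p \<rho> = 0" "\<rho> \<notin> Z" "R \<rho> (\<psi> t)" using R_ex'[OF r] by blast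
      then have "\<psi> \<rho> = \<psi> t" using R_uniq[OF gR[OF rho(1,2)] rho(3)] psi_T[of \<rho>] by (simp add: T_def)
      then have "\<rho> = t" by (simp add: strict_mono_eq[OF psi(1)])
      then show ?thesis using rho(1) by simp
    qed
  qed
  have no_root': "poly p' y \<noteq> 0" if "\<And>x. a \<le> x \<Longrightarrow> x \<le> b \<Longrightarrow> poly p x \<noteq> 0" "\<psi> a \<le> y" "y \<le> \<psi> b" for a b y
  proof -
    obtain x where x: "y = \<psi> x" using psi(2) by (auto simp: surj_def)
    then have "a \<le> x" "x \<le> b" using that strict_mono_less_eq[OF psi(1)] by auto
    then show ?thesis using that(1) psi_roots x by blast
  qed
  \<comment> \<open>Roots of \<open>p\<close> and \<open>p'\<close> correspond exactly, so agreement of the signs propagates along any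
    interval without a root of \<open>p\<close>.\<close>
  have same: "sgn (poly p b) = sgn (poly p' (\<psi> b))"
    if "sgn (poly p a) = sgn (poly p' (\<psi> a))" "\<And>x. min a b \<le> x \<Longrightarrow> x \<le> max a b \<Longrightarrow> poly p x \<noteq> 0" for a b
  proof -
    have "sgn (poly p a) = sgn (poly p b)" using sgn_poly_eq_if_no_root that(2) by blast
    moreover have "\<psi> (min a b) = min (\<psi> a) (\<psi> b)" "\<psi> (max a b) = max (\<psi> a) (\<psi> b)"
      using strict_mono_less_eq[OF psi(1)] by (auto simp: min_def max_def)
    then have "sgn (poly p' (\<psi> a)) = sgn (poly p' (\<psi> b))"
      by (intro sgn_poly_eq_if_no_root no_root'[of "min a b" "max a b"] that(2)) auto
    ultimately show ?thesis using that(1) by simp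
  qed
  have "sgn (poly p t) = sgn (poly p' (\<psi> t))" for t
  proof (cases "poly p t = 0 \<or> t \<in> Z")
    case True
    then show ?thesis using psi_roots[of t] psi_Z[of t] sgn_Z[of t] by auto
  next
    case False
    show ?thesis
    proof (cases "\<exists>x\<in>T. x < t")
      case none: False
      then have "t \<le> l" using lu by (force simp: T_def)
      moreover have "poly p x \<noteq> 0" if "x \<le> l" for x using l1[OF that] s0 by auto
      ultimately show ?thesis using same[of l t] sgn_Z[OF lu(1)] psi_Z[OF lu(1)] by auto
    next
      case True
      \<comment> \<open>The sign at \<open>t\<close> is read off at the nearest point \<open>a\<close> of \<open>T\<close> below: from \<open>p\<close> itself if
        \<open>p\<close> does not vanish there, and otherwise from the derivative to the right of \<open>a\<close>.\<close>
      define a where "a = Max {x\<in>T. x < t}"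
      have "a \<in> {x\<in>T. x < t}" unfolding a_def by (rule Max_in) (use True finT in auto)
      then have a: "a \<in> T" "a < t" by auto
      have gap: "x \<notin> T" if "a < x" "x \<le> t" for x
      proof
        assume x: "x \<in> T"
        then have "x < t" using that False by (auto simp: T_def order_less_le)
        then have "x \<le> a" unfolding a_def using x finT by auto
        then show False using that by simp
      qed
      show ?thesis
      proof (cases "poly p a = 0")
        case False
        then have "a \<in> Z" using a by (auto simp: T_def)
        then have "sgn (poly p a) = sgn (poly p' (\<psi> a))" using sgn_Z psi_Z by auto
        moreover have "poly p x \<noteq> 0" if "min a t \<le> x" "x \<le> max a t" for x
          using that gap[of x] False a by (cases "x = a") (auto simp: T_def)
        ultimately show ?thesis by (rule same)
      next
        case True
        obtain x where x: "a < x" "x < t" "poly p t = (t - a) * poly (pderiv p) x"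
          using poly_MVT[OF a(2), of p] True by auto
        have "\<psi> a < \<psi> t" using a by simp
        from poly_MVT[OF this, of p'] obtain y' where y': "\<psi> a < y'" "y' < \<psi> t"
           "poly p' (\<psi> t) = (\<psi> t - \<psi> a) * poly (pderiv p') y'" using True psi_roots[of a] by auto
        obtain y where y: "y' = \<psi> y" using psi(2) by (auto simp: surj_def)
        then have y_bd: "a < y" "y < t" using y' by auto
        have "sgn (poly (pderiv p) x) = sgn (poly (pderiv p) y)"
        proof (rule sgn_poly_eq_if_no_root)
          fix w assume "min x y \<le> w" "w \<le> max x y"
          then have "w \<notin> T" using gap x y_bd by auto
          then show "poly (pderiv p) w \<noteq> 0" using crit[of w] by (auto simp: T_def)
        qed
        also have "\<dots> = sgn (poly (pderiv p') y')" using I'[OF d(1), of y] d y by simp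
        finally show ?thesis unfolding x(3) y'(3) using a by (simp add: sgn_mult)
      qed
    qed
  qed
  then show ?thesis using that[OF psi I'] by blast
qed

section \<open>Sign diagrams over a parameter space\<close>

definition real_hom :: "('a::idom \<Rightarrow> real) \<Rightarrow> bool" where
  "real_hom h \<longleftrightarrow> h 1 = 1 \<and> (\<forall>a b. h (a + b) = h a + h b) \<and> (\<forall>a b. h (a * b) = h a * h b)"

lemma real_hom_1: "real_hom h \<Longrightarrow> h 1 = 1"
  and real_hom_add: "real_hom h \<Longrightarrow> h (a + b) = h a + h b"
  and real_hom_mult: "real_hom h \<Longrightarrow> h (a * b) = h a * h b"
  by (auto simp: real_hom_def)

lemma real_hom_0: "real_hom h \<Longrightarrow> h 0 = 0"
  using real_hom_add[of h 0 0] by simp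

lemma real_hom_minus: "real_hom h \<Longrightarrow> h (- a) = - h a"
  using real_hom_add[of h a "- a"] real_hom_0[of h] by simp

lemma real_hom_diff: "real_hom h \<Longrightarrow> h (a - b) = h a - h b"
  using real_hom_add[of h a "- b"] real_hom_minus[of h b] by simp

lemma real_hom_of_nat: "real_hom h \<Longrightarrow> h (of_nat n) = of_nat n"
  by (induction n) (auto simp: real_hom_0 real_hom_1 real_hom_add)

lemma real_hom_power: "real_hom h \<Longrightarrow> h (a ^ n) = h a ^ n"
  by (induction n) (auto simp: real_hom_1 real_hom_mult)

text \<open>
  The point of the larger parameter space that lies over \<open>h\<close> and has \<open>t\<close> as its new coordinate.
\<close>

definition extend_hom :: "('a::idom \<Rightarrow> real) \<Rightarrow> real \<Rightarrow> 'a poly \<Rightarrow> real" where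
  "extend_hom h t p = poly (map_poly h p) t"

lemma extend_hom_0: "extend_hom h t 0 = 0"
  by (simp add: extend_hom_def)

lemma extend_hom_pCons: "real_hom h \<Longrightarrow> extend_hom h t (pCons a p) = h a + t * extend_hom h t p"
  by (simp add: extend_hom_def map_poly_pCons real_hom_0)

lemma extend_hom_const: "real_hom h \<Longrightarrow> extend_hom h t [:a:] = h a"
  by (simp add: extend_hom_pCons extend_hom_0)

lemma extend_hom_var: "real_hom h \<Longrightarrow> extend_hom h t [:0, 1:] = t"
  by (simp add: extend_hom_pCons extend_hom_0 real_hom_0 real_hom_1)

lemma real_hom_extend_hom:
  assumes h: "real_hom h"
  shows "real_hom (extend_hom h t)"
proof -
  have 1: "extend_hom h t 1 = 1"
    using extend_hom_const[OF h, of t 1] h by (simp add: real_hom_1 one_pCons)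
  have add: "extend_hom h t (p + q) = extend_hom h t p + extend_hom h t q" for p q
  proof (induction p arbitrary: q)
    case (pCons a p)
    show ?case
      by (cases q) (simp add: extend_hom_pCons h pCons.IH real_hom_add distrib_left)
  qed (simp add: extend_hom_0)
  have smult: "extend_hom h t (smult a p) = h a * extend_hom h t p" for a p
    by (induction p) (simp_all add: extend_hom_0 extend_hom_pCons h real_hom_mult algebra_simps)
  have "extend_hom h t (p * q) = extend_hom h t p * extend_hom h t q" for p q
    by (induction p)
       (simp_all add: extend_hom_0 extend_hom_pCons h add smult real_hom_0 algebra_simps)
  with 1 add show ?thesis by (simp add: real_hom_def)
qed

lemma map_poly_pderiv:
  assumes h: "real_hom h"
  shows "map_poly h (pderiv p) = pderiv (map_poly h p)"
  using h real_hom_of_nat[OF h, of "Suc n" for n] by (intro poly_eqI)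
    (simp add: coeff_map_poly coeff_pderiv real_hom_0 real_hom_mult del: of_nat_Suc)

definition same_signs :: "'a set \<Rightarrow> ('a \<Rightarrow> real) \<Rightarrow> ('a \<Rightarrow> real) \<Rightarrow> bool" where
  "same_signs G h h' \<longleftrightarrow> (\<forall>g\<in>G. sgn (h g) = sgn (h' g))"

definition same_diagram :: "'a::idom poly set \<Rightarrow> ('a \<Rightarrow> real) \<Rightarrow> ('a \<Rightarrow> real) \<Rightarrow> bool" where
  "same_diagram Q h h' \<longleftrightarrow>
     (\<exists>\<phi>. strict_mono \<phi> \<and> surj \<phi> \<and> (\<forall>t. same_signs Q (extend_hom h t) (extend_hom h' (\<phi> t))))"

definition diagram_controlled :: "'a::idom poly set \<Rightarrow> bool" where
  "diagram_controlled Q \<longleftrightarrow>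
     (\<exists>H. finite H \<and> (\<forall>h h'. real_hom h \<longrightarrow> real_hom h' \<longrightarrow> same_signs H h h' \<longrightarrow> same_diagram Q h h'))"

text \<open>
  Pseudo-remainders of \<open>p\<close> modulo all truncations of the members of \<open>Q\<close>. The truncations are there
  because the leading coefficients of \<open>q\<close> may vanish under a specialisation; the specialisation of
  \<open>q\<close> then is zero or equals that of some truncation whose leading coefficient survives.
\<close>

definition reduction_set :: "'a::idom poly \<Rightarrow> 'a poly set \<Rightarrow> 'a poly set" where
  "reduction_set p Q =
     (\<Union>q\<in>Q. (\<lambda>j. snd (pseudo_divmod p (poly_cutoff j q))) ` {j. j \<le> Suc (degree q) \<and> poly_cutoff j q \<noteq> 0})"

lemma finite_reduction_set: "finite Q \<Longrightarrow> finite (reduction_set p Q)"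
  unfolding reduction_set_def by (intro finite_UN_I finite_imageI) auto

lemma degree_poly_cutoff_le: "degree (poly_cutoff j q) \<le> degree q"
  by (rule degree_le) (auto simp: coeff_poly_cutoff coeff_eq_0)

lemma degree_reduction_set:
  assumes "r \<in> reduction_set p Q" "\<And>q. q \<in> Q \<Longrightarrow> degree q \<le> n" "n > 0"
  shows "degree r < n"
proof -
  obtain q j where q: "q \<in> Q" "r = snd (pseudo_divmod p (poly_cutoff j q))" "poly_cutoff j q \<noteq> 0"
    using assms(1) unfolding reduction_set_def by auto
  have "r = 0 \<or> degree r < degree (poly_cutoff j q)"
    by (rule pseudo_divmod(2)[OF q(3), of p "fst (pseudo_divmod p (poly_cutoff j q))"]) (simp add: q(2))
  then show ?thesis using degree_poly_cutoff_le[of j q] assms(2)[OF q(1)] assms(3) by auto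
qed

text \<open>
  At a root of \<open>q\<close>, the polynomial \<open>p\<close> agrees with its pseudo-remainder modulo \<open>q\<close> up to a power of
  the leading coefficient of the divisor. This turns signs of \<open>p\<close> at such roots into signs of polynomials of smaller
  degree.
\<close>

lemma sgn_extend_hom_at_root:
  fixes p q :: "'a::idom poly"
  assumes h: "real_hom h" and h': "real_hom h'"
    and q: "q \<in> Q"
    and coeffs: "same_signs (coeff q ` UNIV) h h'"
    and red: "same_signs (reduction_set p Q) (extend_hom h t) (extend_hom h' t')"
    and same: "sgn (extend_hom h t q) = sgn (extend_hom h' t' q)"
    and nz: "map_poly h q \<noteq> 0" and root: "extend_hom h t q = 0"
  shows "sgn (extend_hom h t p) = sgn (extend_hom h' t' p)"
proof -
  have sgn_coeff: "sgn (h (coeff q i)) = sgn (h' (coeff q i))" for i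
    using coeffs by (auto simp: same_signs_def)
  have coeff0: "h (coeff q i) = 0 \<longleftrightarrow> h' (coeff q i) = 0" for i
    using sgn_coeff[of i] by (metis sgn_zero_iff)
  define m where "m = degree (map_poly h q)"
  have m0: "h (coeff q m) \<noteq> 0"
    using nz unfolding m_def by (metis coeff_map_poly h leading_coeff_0_iff real_hom_0)
  have above: "h (coeff q i) = 0" if "i > m" for i
    using that unfolding m_def by (metis coeff_eq_0 coeff_map_poly h real_hom_0)
  define g where "g = poly_cutoff (Suc m) q"
  have cg: "coeff g i = (if i \<le> m then coeff q i else 0)" for i
    by (simp add: g_def coeff_poly_cutoff less_Suc_eq_le)
  have gm: "coeff g m \<noteq> 0" using m0 h by (auto simp: cg real_hom_0)
  have deg_g: "degree g = m"
    by (rule antisym[OF degree_le le_degree[OF gm]]) (simp add: cg)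
  have g0: "g \<noteq> 0" using gm by auto
  have mle: "m \<le> degree q" using m0 h by (intro le_degree) (auto simp: real_hom_0)
  define r where "r = snd (pseudo_divmod p g)"
  define s where "s = fst (pseudo_divmod p g)"
  define e where "e = Suc (degree p) - degree g"
  have "smult (coeff g (degree g) ^ e) p = g * s + r"
    unfolding e_def by (rule pseudo_divmod(1)[OF g0]) (simp add: r_def s_def)
  then have id: "[:coeff q m ^ e:] * p = g * s + r" by (simp add: deg_g cg)
  have "r \<in> reduction_set p Q"
    unfolding reduction_set_def r_def using q g0 mle by (auto simp: g_def intro!: bexI[of _ q])
  with red have sgn_r: "sgn (extend_hom h t r) = sgn (extend_hom h' t' r)"
    by (auto simp: same_signs_def)
  have eval: "k (coeff q m) ^ e * extend_hom k x p = extend_hom k x g * extend_hom k x s + extend_hom k x r"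
    if k: "real_hom k" for k x
  proof -
    have "extend_hom k x ([:coeff q m ^ e:] * p) = extend_hom k x (g * s + r)" by (simp only: id)
    then show ?thesis
      by (simp add: real_hom_add real_hom_mult real_hom_extend_hom k extend_hom_const real_hom_power
            del: mult_pCons_left)
  qed
  have root': "extend_hom h' t' q = 0" using same root by (simp add: sgn_zero_iff)
  have "map_poly h g = map_poly h q"
    using above h by (intro poly_eqI) (auto simp: coeff_map_poly real_hom_0 cg not_le)
  then have eg: "extend_hom h t g = 0" using root by (simp add: extend_hom_def)
  have "map_poly h' g = map_poly h' q"
    using above coeff0 h' by (intro poly_eqI) (auto simp: coeff_map_poly real_hom_0 cg not_le)
  then have eg': "extend_hom h' t' g = 0" using root' by (simp add: extend_hom_def)
  have "sgn (h (coeff q m)) ^ e * sgn (extend_hom h t p) = sgn (h' (coeff q m)) ^ e * sgn (extend_hom h' t' p)"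
    using eval[OF h, of t] eval[OF h', of t'] sgn_r eg eg'
    by (simp flip: sgn_mult power_sgn)
  moreover have "sgn (h (coeff q m)) ^ e \<noteq> 0" using m0 by (simp add: sgn_zero_iff)
  ultimately show ?thesis using sgn_coeff[of m] by auto
qed

text \<open>
  Either the leading coefficient of \<open>p\<close> vanishes at the parameter point, and \<open>p\<close> may be replaced by
  its truncation, or the specialisation of \<open>p\<close> has the expected degree and \<open>extend_sign_diagram\<close>
  applies.
\<close>

lemma diagram_controlled_insert:
  fixes p :: "'a::idom poly"
  assumes "finite Q"
    and ctrl: "diagram_controlled (Q \<union> ({poly_cutoff (degree p) p, pderiv p} \<union> reduction_set p (insert (pderiv p) Q)))"
      (is "diagram_controlled (Q \<union> ?N)")
    and deg: "degree p > 0"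
  shows "diagram_controlled (insert p Q)"
proof -
  obtain H where H: "finite H"
    "\<And>h h'. real_hom h \<Longrightarrow> real_hom h' \<Longrightarrow> same_signs H h h' \<Longrightarrow> same_diagram (Q \<union> ?N) h h'"
    using ctrl unfolding diagram_controlled_def by blast
  define I where "I = insert (pderiv p) Q"
  define H' where "H' = H \<union> range (coeff p) \<union> (\<Union>q\<in>I. range (coeff q))"
  have fin_coeff: "finite (range (coeff q))" for q :: "'a poly"
  proof -
    have "range (coeff q) \<subseteq> insert 0 (coeff q ` {..degree q})"
      by (auto simp: image_iff) (metis atMost_iff coeff_eq_0 not_le)
    then show ?thesis by (rule finite_subset) auto
  qed
  have "finite H'" using H(1) assms(1) by (auto simp: H'_def I_def fin_coeff)
  moreover have "same_diagram (insert p Q) h h'"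
    if h: "real_hom h" and h': "real_hom h'" and ss: "same_signs H' h h'" for h h'
  proof -
    have "same_signs H h h'" using ss by (auto simp: H'_def same_signs_def)
    from H(2)[OF h h' this] obtain \<phi> where phi: "strict_mono \<phi>" "surj \<phi>"
      "\<And>t. same_signs (Q \<union> ?N) (extend_hom h t) (extend_hom h' (\<phi> t))"
      unfolding same_diagram_def by blast
    have sp: "sgn (h (coeff p i)) = sgn (h' (coeff p i))" for i
      using ss by (auto simp: H'_def same_signs_def)
    show ?thesis
    proof (cases "h (lead_coeff p) = 0")
      case True
      have *: "extend_hom k t p = extend_hom k t (poly_cutoff (degree p) p)"
        if "real_hom k" "k (lead_coeff p) = 0" for k t
      proof -
        have "map_poly k p = map_poly k (poly_cutoff (degree p) p)"
        proof (rule poly_eqI)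
          fix i
          show "coeff (map_poly k p) i = coeff (map_poly k (poly_cutoff (degree p) p)) i"
            using that by (cases i "degree p" rule: linorder_cases)
              (auto simp: coeff_map_poly real_hom_0 coeff_poly_cutoff coeff_eq_0)
        qed
        then show ?thesis by (simp add: extend_hom_def)
      qed
      have "h' (lead_coeff p) = 0" using True sp[of "degree p"] by (simp add: sgn_zero_iff)
      then have "\<forall>t. same_signs (insert p Q) (extend_hom h t) (extend_hom h' (\<phi> t))"
        using phi(3) *[OF h True] *[OF h'] by (auto simp: same_signs_def)
      with phi(1,2) show ?thesis unfolding same_diagram_def by blast
    next
      case False
      have lc': "h' (lead_coeff p) \<noteq> 0" using False sp[of "degree p"] by (metis sgn_zero_iff)
      have lead: "degree (map_poly k p) = degree p" "lead_coeff (map_poly k p) = k (lead_coeff p)"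
        if "real_hom k" "k (lead_coeff p) \<noteq> 0" for k
      proof -
        show "degree (map_poly k p) = degree p"
          using that by (intro antisym degree_le le_degree) (auto simp: coeff_map_poly real_hom_0 coeff_eq_0)
        then show "lead_coeff (map_poly k p) = k (lead_coeff p)"
          using that by (simp add: coeff_map_poly real_hom_0)
      qed
      obtain \<psi> where psi: "strict_mono \<psi>" "surj \<psi>"
        "\<And>q t. q \<in> I \<Longrightarrow> sgn (poly (map_poly h q) t) = sgn (poly (map_poly h' q) (\<psi> t))"
        "\<And>t. sgn (poly (map_poly h p) t) = sgn (poly (map_poly h' p) (\<psi> t))"
      proof (rule extend_sign_diagram[of I \<phi> "map_poly h" "map_poly h'" "pderiv p" "map_poly h p" "map_poly h' p"])
        show "finite I" using assms(1) by (simp add: I_def)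
        show "sgn (poly (map_poly h i) t) = sgn (poly (map_poly h' i) (\<phi> t))" if "i \<in> I" for i t
          using phi(3)[of t] that by (auto simp: same_signs_def extend_hom_def I_def)
        show "sgn (lead_coeff (map_poly h p)) = sgn (lead_coeff (map_poly h' p))"
          using lead[OF h False] lead[OF h' lc'] sp by simp
        show "sgn (poly (map_poly h p) t) = sgn (poly (map_poly h' p) (\<phi> t))"
          if "i \<in> I" "map_poly h i \<noteq> 0" "poly (map_poly h i) t = 0" for i t
        proof -
          have "same_signs (range (coeff i)) h h'" using ss that(1) unfolding H'_def same_signs_def by blast
          moreover have "same_signs (reduction_set p I) (extend_hom h t) (extend_hom h' (\<phi> t))"
            using phi(3)[of t] by (auto simp: same_signs_def I_def)
          moreover have "sgn (extend_hom h t i) = sgn (extend_hom h' (\<phi> t) i)"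
            using phi(3)[of t] that(1) by (auto simp: same_signs_def I_def)
          ultimately show ?thesis
            using sgn_extend_hom_at_root[OF h h' that(1)] that(2,3) by (simp add: extend_hom_def)
        qed
      qed (use phi deg lead[OF h False] lead[OF h' lc'] in \<open>auto simp: I_def map_poly_pderiv h h'\<close>)
      then have "\<forall>t. same_signs (insert p Q) (extend_hom h t) (extend_hom h' (\<psi> t))"
        by (auto simp: same_signs_def extend_hom_def I_def)
      with psi(1,2) show ?thesis unfolding same_diagram_def by blast
    qed
  qed
  ultimately show ?thesis unfolding diagram_controlled_def by blast
qed

lemma diagram_controlled_constants:
  fixes M :: "'a::idom poly set"
  assumes "finite M" "\<And>q. q \<in> M \<Longrightarrow> degree q = 0"
  shows "diagram_controlled M"
proof -
  have const: "extend_hom h t q = h (coeff q 0)" if "real_hom h" "q \<in> M" for h t and q :: "'a poly"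
    using assms(2)[OF that(2)] extend_hom_const[OF that(1)] by (metis degree_eq_zeroE coeff_pCons_0)
  have "same_diagram M h h'"
    if "real_hom h" "real_hom h'" "same_signs ((\<lambda>q. coeff q 0) ` M) h h'" for h h'
    unfolding same_diagram_def
    by (rule exI[of _ id]) (use that const in \<open>auto simp: same_signs_def strict_mono_def\<close>)
  with assms(1) show ?thesis unfolding diagram_controlled_def by (meson finite_imageI)
qed

text \<open>
  The double induction behind the method: a polynomial of top degree \<open>n\<close> is removed from \<open>M\<close> at the
  price of finitely many polynomials of smaller degree, which go to \<open>L\<close>; once \<open>M\<close> is empty, \<open>n\<close>
  decreases.
\<close>

lemma diagram_controlled_degree:
  fixes L M :: "'a::idom poly set"
  assumes "finite L" "finite M" "\<And>q. q \<in> L \<Longrightarrow> degree q < n" "\<And>q. q \<in> M \<Longrightarrow> degree q = n"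
  shows "diagram_controlled (L \<union> M)"
  using assms
proof (induction n arbitrary: L M)
  case 0
  then show ?case by (intro diagram_controlled_constants) auto
next
  case (Suc n)
  show ?case using Suc.prems(2,1,3,4)
  proof (induction M arbitrary: L rule: finite_induct)
    case empty
    have "L = {q\<in>L. degree q < n} \<union> {q\<in>L. degree q = n}" using empty by (auto simp: less_Suc_eq)
    moreover have "diagram_controlled \<dots>" by (rule Suc.IH) (use empty in auto)
    ultimately show ?case by simp
  next
    case (insert p M)
    let ?N = "{poly_cutoff (degree p) p, pderiv p} \<union> reduction_set p (Set.insert (pderiv p) (L \<union> M))"
    have deg_p: "degree p = Suc n" using insert by auto
    have "diagram_controlled ((L \<union> ?N) \<union> M)"
    proof (rule insert.IH)
      show "finite (L \<union> ?N)" using insert by (auto intro: finite_reduction_set)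
      fix q assume "q \<in> L \<union> ?N"
      then consider "q \<in> L" | "q = poly_cutoff (degree p) p" | "q = pderiv p"
        | "q \<in> reduction_set p (Set.insert (pderiv p) (L \<union> M))" by blast
      then show "degree q < Suc n"
      proof cases
        case 2
        have "degree (poly_cutoff (degree p) p) \<le> n"
          by (rule degree_le) (auto simp: coeff_poly_cutoff deg_p)
        with 2 show ?thesis by simp
      next
        case 3
        have "degree (pderiv p) \<le> n"
          by (rule degree_le) (auto simp: coeff_pderiv coeff_eq_0 deg_p)
        with 3 show ?thesis by simp
      next
        case 4
        have "degree q \<le> Suc n" if "q \<in> Set.insert (pderiv p) (L \<union> M)" for q
        proof -
          have "degree (pderiv p) \<le> n"
            by (rule degree_le) (auto simp: coeff_pderiv coeff_eq_0 deg_p)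
          then show ?thesis using that insert.prems(2)[of q] insert.prems(3)[of q] by auto
        qed
        then show ?thesis by (rule degree_reduction_set[OF 4]) auto
      qed (use insert in auto)
    qed (use insert in auto)
    then have "diagram_controlled (Set.insert p (L \<union> M))"
      by (intro diagram_controlled_insert) (use insert deg_p in \<open>auto simp: Un_ac\<close>)
    then show ?case by simp
  qed
qed

lemma diagram_controlled_finite:
  fixes Q :: "'a::idom poly set"
  assumes "finite Q"
  shows "diagram_controlled Q"
proof -
  have "diagram_controlled (Q \<union> {})"
    by (rule diagram_controlled_degree[of _ _ "Suc (Max (degree ` Q))"]) (use assms in \<open>auto simp: less_Suc_eq_le\<close>)
  then show ?thesis by simp
qed

section \<open>Elimination of a real quantifier\<close>

text \<open>
  A semantic form of being a Boolean combination of polynomial sign conditions. Closure under the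
  logical connectives is immediate in this form: finite controlling sets are united.
\<close>

definition sign_definable :: "(('a::idom \<Rightarrow> real) \<Rightarrow> bool) \<Rightarrow> bool" where
  "sign_definable S \<longleftrightarrow>
     (\<exists>G. finite G \<and> (\<forall>h h'. real_hom h \<longrightarrow> real_hom h' \<longrightarrow> same_signs G h h' \<longrightarrow> S h = S h'))"

text \<open>
  Quantifier elimination. In the premise the bound variable \<open>t\<close> has become the new polynomial
  variable \<open>[:0, 1:]\<close>, and the old elements \<open>a\<close> appear as constants \<open>[:a:]\<close>; an increasing bijection that
  matches sign diagrams sends a witness over \<open>h\<close> to a witness over \<open>h'\<close>.
\<close>

theorem sign_definable_ex:
  fixes S :: "('a::idom \<Rightarrow> real) \<Rightarrow> real \<Rightarrow> bool"
  assumes "sign_definable (\<lambda>h. S (\<lambda>a. h [:a:]) (h [:0, 1:]))"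
  shows "sign_definable (\<lambda>h. \<exists>t. S h t)"
proof -
  obtain G where G: "finite G" "\<And>h h'. real_hom h \<Longrightarrow> real_hom h' \<Longrightarrow> same_signs G h h' \<Longrightarrow>
      S (\<lambda>a. h [:a:]) (h [:0, 1:]) = S (\<lambda>a. h' [:a:]) (h' [:0, 1:])"
    using assms unfolding sign_definable_def by blast
  obtain H where H: "finite H"
    "\<And>h h'. real_hom h \<Longrightarrow> real_hom h' \<Longrightarrow> same_signs H h h' \<Longrightarrow> same_diagram G h h'"
    using diagram_controlled_finite[OF G(1)] unfolding diagram_controlled_def by blast
  have transfer: "\<exists>t. S h' t"
    if h: "real_hom h" and h': "real_hom h'" and ss: "same_signs H h h'" and t: "S h t" for h h' t
  proof -
    obtain \<phi> where "\<forall>t. same_signs G (extend_hom h t) (extend_hom h' (\<phi> t))"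
      using H(2)[OF h h' ss] unfolding same_diagram_def by blast
    then have "S h t = S h' (\<phi> t)"
      using G(2)[of "extend_hom h t" "extend_hom h' (\<phi> t)"] h h'
      by (simp add: real_hom_extend_hom extend_hom_const extend_hom_var)
    then show ?thesis using t by blast
  qed
  have "same_signs H h' h" if "same_signs H h h'" for h h' using that by (auto simp: same_signs_def)
  then show ?thesis unfolding sign_definable_def using H(1) transfer by blast
qed

definition poly_term :: "(('a::idom \<Rightarrow> real) \<Rightarrow> real) \<Rightarrow> bool" where
  "poly_term f \<longleftrightarrow> (\<exists>a. \<forall>h. real_hom h \<longrightarrow> f h = h a)"

text \<open>
  The rules collected under \<open>definable\<close> decompose a formula from the outside: a quantifier passes to
  the next polynomial ring, so that in the end all variables appear in the form \<open>h a\<close>, and the atoms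
  compare polynomial expressions in them.
\<close>

named_theorems definable

lemma poly_term_elem [definable]: "poly_term (\<lambda>h. h a)"
  by (auto simp: poly_term_def)

lemma poly_term_of_nat: "poly_term (\<lambda>h. of_nat n)"
  unfolding poly_term_def by (rule exI[of _ "of_nat n"]) (simp add: real_hom_of_nat)

lemma poly_term_0 [definable]: "poly_term (\<lambda>h. 0)"
  and poly_term_1 [definable]: "poly_term (\<lambda>h. 1)"
  and poly_term_numeral [definable]: "poly_term (\<lambda>h. numeral n)"
  using poly_term_of_nat[of 0] poly_term_of_nat[of 1] poly_term_of_nat[of "numeral n"] by simp_all

lemma poly_term_add [definable]: "poly_term f \<Longrightarrow> poly_term g \<Longrightarrow> poly_term (\<lambda>h. f h + g h)"
  unfolding poly_term_def by (metis real_hom_add)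

lemma poly_term_diff [definable]: "poly_term f \<Longrightarrow> poly_term g \<Longrightarrow> poly_term (\<lambda>h. f h - g h)"
  unfolding poly_term_def by (metis real_hom_diff)

lemma poly_term_mult [definable]: "poly_term f \<Longrightarrow> poly_term g \<Longrightarrow> poly_term (\<lambda>h. f h * g h)"
  unfolding poly_term_def by (metis real_hom_mult)

lemma poly_term_power [definable]: "poly_term f \<Longrightarrow> poly_term (\<lambda>h. f h ^ n)"
  unfolding poly_term_def by (metis real_hom_power)

lemma sign_definable_le [definable]:
  assumes "poly_term f" "poly_term g"
  shows "sign_definable (\<lambda>h. f h \<le> g h)"
proof -
  obtain a where a: "\<And>h. real_hom h \<Longrightarrow> g h - f h = h a"
    using poly_term_diff[OF assms(2,1)] by (auto simp: poly_term_def)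
  have "f h \<le> g h \<longleftrightarrow> sgn (h a) \<noteq> -1" if "real_hom h" for h
    using a[OF that] by (auto simp: sgn_if)
  then show ?thesis unfolding sign_definable_def
    by (intro exI[of _ "{a}"]) (auto simp: same_signs_def)
qed

lemma sign_definable_not [definable]: "sign_definable S \<Longrightarrow> sign_definable (\<lambda>h. \<not> S h)"
  unfolding sign_definable_def by meson

lemma sign_definable_conj [definable]:
  assumes "sign_definable S" "sign_definable T"
  shows "sign_definable (\<lambda>h. S h \<and> T h)"
proof -
  obtain G G' where "finite G" "finite G'"
    and G: "\<And>h h'. real_hom h \<Longrightarrow> real_hom h' \<Longrightarrow> same_signs G h h' \<Longrightarrow> S h = S h'"
    and G': "\<And>h h'. real_hom h \<Longrightarrow> real_hom h' \<Longrightarrow> same_signs G' h h' \<Longrightarrow> T h = T h'"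
    using assms unfolding sign_definable_def by blast
  moreover have "same_signs G h h' \<and> same_signs G' h h'" if "same_signs (G \<union> G') h h'" for h h'
    using that by (auto simp: same_signs_def)
  ultimately show ?thesis unfolding sign_definable_def by (intro exI[of _ "G \<union> G'"]) blast
qed

lemma sign_definable_imp [definable]:
  assumes "sign_definable S" "sign_definable T"
  shows "sign_definable (\<lambda>h. S h \<longrightarrow> T h)"
proof -
  have "sign_definable (\<lambda>h. \<not> (S h \<and> \<not> T h))" by (intro definable assms)
  then show ?thesis by simp
qed

lemma sign_definable_eq [definable]:
  assumes "poly_term f" "poly_term g"
  shows "sign_definable (\<lambda>h. f h = g h)"
proof -
  have "sign_definable (\<lambda>h. f h \<le> g h \<and> g h \<le> f h)" by (intro definable assms)
  then show ?thesis by (simp add: eq_iff)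
qed

declare sign_definable_ex [definable]

lemma sign_definable_all [definable]:
  fixes S :: "('a::idom \<Rightarrow> real) \<Rightarrow> real \<Rightarrow> bool"
  assumes "sign_definable (\<lambda>h. S (\<lambda>a. h [:a:]) (h [:0, 1:]))"
  shows "sign_definable (\<lambda>h. \<forall>t. S h t)"
proof -
  have "sign_definable (\<lambda>h. \<not> (\<exists>t. \<not> S h t))" by (intro definable assms)
  then show ?thesis by simp
qed

section \<open>Definable functions are algebraic\<close>

lemma real_hom_eval2: "real_hom (\<lambda>P. eval2 P x y)"
  by (simp add: real_hom_def eval2_def)

lemma eval2_fst: "eval2 [:[:0, 1:]:] x y = x"
  and eval2_snd: "eval2 [:0, 1:] x y = y"
  by (simp_all add: eval2_def)

lemma isCont_eval2: "isCont (eval2 P x) y"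
proof -
  have "eval2 (pCons a P) x = (\<lambda>y. poly a x + y * eval2 P x y)" for a P
    by (auto simp: eval2_def)
  then show ?thesis
    by (induction P) (auto simp: eval2_def[of 0, abs_def] intro!: continuous_intros)
qed

text \<open>
  If no nonzero member of the controlling set \<open>G\<close> vanished at a point of the graph, then all signs
  would be the same at a nearby point on the same vertical line, which would then also belong to the
  graph.
\<close>

lemma definable_function_algebraic:
  fixes \<Gamma> :: "real \<Rightarrow> real \<Rightarrow> bool"
  assumes def: "sign_definable (\<lambda>h::real poly poly \<Rightarrow> real. \<Gamma> (h [:[:0, 1:]:]) (h [:0, 1:]))"
    and uniq: "\<And>x y y'. \<Gamma> x y \<Longrightarrow> \<Gamma> x y' \<Longrightarrow> y = y'"
  shows "\<exists>P. P \<noteq> 0 \<and> (\<forall>x y. \<Gamma> x y \<longrightarrow> eval2 P x y = 0)"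
proof -
  obtain G where "finite G" and G: "\<And>h h' :: real poly poly \<Rightarrow> real.
      real_hom h \<Longrightarrow> real_hom h' \<Longrightarrow> same_signs G h h' \<Longrightarrow>
     \<Gamma> (h [:[:0, 1:]:]) (h [:0, 1:]) = \<Gamma> (h' [:[:0, 1:]:]) (h' [:0, 1:])"
    using def unfolding sign_definable_def by blast
  define P where "P = \<Prod>(G - {0})"
  have P_eval: "eval2 P x y = (\<Prod>g\<in>G - {0}. eval2 g x y)" for x y
    unfolding P_def eval2_def by (simp add: poly_prod)
  have "eval2 P x y = 0" if "\<Gamma> x y" for x y
  proof (rule ccontr)
    assume nz: "eval2 P x y \<noteq> 0"
    have "\<forall>\<^sub>F z in at y. sgn (eval2 g x z) = sgn (eval2 g x y)" if "g \<in> G" for g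
    proof (cases "g = 0")
      case False
      then have "eval2 g x y \<noteq> 0" using nz that \<open>finite G\<close> by (auto simp: P_eval)
      moreover have "((\<lambda>z. eval2 g x z) \<longlongrightarrow> eval2 g x y) (at y)"
        using isCont_eval2 by (simp add: isCont_def)
      ultimately consider "eval2 g x y > 0" "\<forall>\<^sub>F z in at y. eval2 g x z > 0"
        | "eval2 g x y < 0" "\<forall>\<^sub>F z in at y. eval2 g x z < 0"
        using order_tendstoD by (metis linorder_neqE_linordered_idom)
      then show ?thesis by cases (auto elim!: eventually_mono)
    qed (simp add: eval2_def)
    then have "\<forall>\<^sub>F z in at y. \<forall>g\<in>G. sgn (eval2 g x z) = sgn (eval2 g x y)"
      using \<open>finite G\<close> by (simp add: eventually_ball_finite)
    moreover have "\<forall>\<^sub>F z in at y. z \<noteq> y" by (simp add: eventually_at_filter)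
    ultimately have "\<forall>\<^sub>F z in at y. z \<noteq> y \<and> (\<forall>g\<in>G. sgn (eval2 g x z) = sgn (eval2 g x y))"
      by eventually_elim simp
    then obtain z where z: "z \<noteq> y" "\<forall>g\<in>G. sgn (eval2 g x z) = sgn (eval2 g x y)"
      using eventually_happens[of _ "at y"] by (auto simp: trivial_limit_at)
    then have "\<Gamma> x z"
      using G[OF real_hom_eval2 real_hom_eval2, of x z x y] \<open>\<Gamma> x y\<close>
      by (simp add: same_signs_def eval2_fst eval2_snd)
    with uniq[OF \<open>\<Gamma> x y\<close>] z(1) show False by simp
  qed
  moreover have "P \<noteq> 0" using \<open>finite G\<close> by (simp add: P_def)
  ultimately show ?thesis by blast
qed

text \<open>
  The exceptional constant value \<open>c\<close> contributes the factor \<open>y - c\<close>.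
\<close>

lemma algebraic_on_if_definable:
  assumes "sign_definable (\<lambda>h::real poly poly \<Rightarrow> real. \<Gamma> (h [:[:0, 1:]:]) (h [:0, 1:]))"
    and "\<And>x y y'. \<Gamma> x y \<Longrightarrow> \<Gamma> x y' \<Longrightarrow> y = y'"
    and f: "\<And>x. x \<in> I \<Longrightarrow> \<Gamma> x (f x) \<or> f x = c"
  shows "algebraic_on I f"
proof -
  have "\<exists>P. P \<noteq> 0 \<and> (\<forall>x y. \<Gamma> x y \<longrightarrow> eval2 P x y = 0)"
    by (rule definable_function_algebraic) (fact assms(1,2))+
  then obtain P where P: "P \<noteq> 0" "\<And>x y. \<Gamma> x y \<Longrightarrow> eval2 P x y = 0" by auto
  define Q where "Q = P * [:- [:c:], 1:]"
  have Q: "eval2 Q x y = eval2 P x y * (y - c)" for x y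
    by (simp add: Q_def eval2_def del: mult_pCons_right)
  have "Q \<noteq> 0" using P(1) unfolding Q_def by (simp del: mult_pCons_right)
  moreover have "eval2 Q x (f x) = 0" if "x \<in> I" for x
    using f[OF that] P(2)[of x "f x"] unfolding Q by auto
  ultimately show ?thesis unfolding algebraic_on_def by blast
qed

section \<open>The minimal square is definable\<close>

definition coord_region :: "real \<Rightarrow> real \<Rightarrow> real \<Rightarrow> real \<Rightarrow> bool" where
  "coord_region w r x y \<longleftrightarrow> 0 \<le> x \<and> x \<le> 2 * w \<and> 0 \<le> y \<and> y * (r + 1) \<le> 2 * r \<and>
     1 \<le> x ^ 2 + (y - 1) ^ 2 \<and> r ^ 2 \<le> (x - 2 * w) ^ 2 + (y - r) ^ 2"

definition square_point :: "real \<Rightarrow> real \<Rightarrow> real \<Rightarrow> real \<Rightarrow> (real \<Rightarrow> real \<Rightarrow> bool) \<Rightarrow> real \<Rightarrow> real \<Rightarrow> bool" where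
  "square_point x y a b S t u \<longleftrightarrow> 0 \<le> t \<and> t \<le> 1 \<and> 0 \<le> u \<and> u \<le> 1 \<and> S (x + (t * a - u * b)) (y + (t * b + u * a))"

text \<open>
  Admissibility of a side length as a first-order formula. The existentially quantified \<open>w\<close> stands for
  \<open>sqrt r\<close>; containment of the square is expressed as not meeting the complement of the region, which
  lets all four conditions have the same shape.
\<close>

definition coord_admissible :: "real \<Rightarrow> real \<Rightarrow> bool" where
  "coord_admissible r s \<longleftrightarrow>
     (\<exists>w. 0 \<le> w \<and> w ^ 2 = r \<and> (\<exists>x y a b. \<not> (a = 0 \<and> b = 0) \<and> 0 \<le> s \<and> s ^ 2 = a ^ 2 + b ^ 2 \<and>
        \<not> (\<exists>t u. square_point x y a b (\<lambda>x y. \<not> coord_region w r x y) t u) \<and>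
        (\<exists>t u. square_point x y a b (\<lambda>x y. x ^ 2 + (y - 1) ^ 2 = 1) t u) \<and>
        (\<exists>t u. square_point x y a b (\<lambda>x y. (x - 2 * w) ^ 2 + (y - r) ^ 2 = r ^ 2) t u) \<and>
        (\<exists>t u. square_point x y a b (\<lambda>x y. y = 0) t u)))"

lemma square_eq_image:
  "square p v = (\<lambda>z. p + z * v) ` {z. 0 \<le> Re z \<and> Re z \<le> 1 \<and> 0 \<le> Im z \<and> Im z \<le> 1}"
    (is "_ = ?f ` ?B")
proof
  have "?B = cbox 0 (Complex 1 1)" by (auto simp: in_cbox_complex_iff)
  then have "convex ((\<lambda>z. z * v) ` ?B)"
    by (intro convex_linear_image bounded_linear.linear[OF bounded_linear_mult_left]) simp
  from convex_translation[OF this, of p] have "convex (?f ` ?B)" by (simp add: image_image)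
  moreover have "{p, p + v, p + v + \<i> * v, p + \<i> * v} \<subseteq> ?f ` ?B"
    by (auto simp: algebra_simps intro: image_eqI[of _ _ 0] image_eqI[of _ _ 1]
        image_eqI[of _ _ "1 + \<i>"] image_eqI[of _ _ \<i>])
  ultimately show "square p v \<subseteq> ?f ` ?B" unfolding square_def by (intro hull_minimal)
next
  show "?f ` ?B \<subseteq> square p v"
  proof safe
    fix z assume z: "0 \<le> Re z" "Re z \<le> 1" "0 \<le> Im z" "Im z \<le> 1"
    let ?S = "square p v"
    have cv: "convex ?S" by (simp add: square_def)
    have v: "p \<in> ?S" "p + v \<in> ?S" "p + v + \<i> * v \<in> ?S" "p + \<i> * v \<in> ?S"
      unfolding square_def by (auto intro: hull_inc)
    have 1: "(1 - Re z) *\<^sub>R p + Re z *\<^sub>R (p + v) \<in> ?S"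
      by (rule convexD[OF cv v(1) v(2)]) (use z in auto)
    have 2: "(1 - Re z) *\<^sub>R (p + \<i> * v) + Re z *\<^sub>R (p + v + \<i> * v) \<in> ?S"
      by (rule convexD[OF cv v(4) v(3)]) (use z in auto)
    have "(1 - Im z) *\<^sub>R ((1 - Re z) *\<^sub>R p + Re z *\<^sub>R (p + v)) +
        Im z *\<^sub>R ((1 - Re z) *\<^sub>R (p + \<i> * v) + Re z *\<^sub>R (p + v + \<i> * v)) \<in> ?S"
      by (rule convexD[OF cv 1 2]) (use z in auto)
    also have "(1 - Im z) *\<^sub>R ((1 - Re z) *\<^sub>R p + Re z *\<^sub>R (p + v)) +
        Im z *\<^sub>R ((1 - Re z) *\<^sub>R (p + \<i> * v) + Re z *\<^sub>R (p + v + \<i> * v)) = p + z * v"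
      by (simp add: complex_eq_iff algebra_simps)
    finally show "p + z * v \<in> ?S" .
  qed
qed

lemma square_meets_iff:
  assumes "\<And>x y. Complex x y \<in> A \<longleftrightarrow> S x y"
  shows "square (Complex x y) (Complex a b) \<inter> A \<noteq> {} \<longleftrightarrow> (\<exists>t u. square_point x y a b S t u)"
proof -
  have *: "Complex x y + Complex t u * Complex a b =
      Complex (x + (t * a - u * b)) (y + (t * b + u * a))" for t u
    by (simp add: complex_eq_iff)
  have ex: "(\<exists>z. Q z) \<longleftrightarrow> (\<exists>t u. Q (Complex t u))" for Q by (metis complex.collapse)
  have "square (Complex x y) (Complex a b) \<inter> A \<noteq> {} \<longleftrightarrow>
      (\<exists>z. 0 \<le> Re z \<and> Re z \<le> 1 \<and> 0 \<le> Im z \<and> Im z \<le> 1 \<and> Complex x y + z * Complex a b \<in> A)"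
    unfolding square_eq_image by blast
  then show ?thesis unfolding ex * assms square_point_def by simp
qed

lemma sphere_Complex_iff: "r \<ge> 0 \<Longrightarrow> Complex x y \<in> sphere (Complex c d) r \<longleftrightarrow> (x - c) ^ 2 + (y - d) ^ 2 = r ^ 2"
  by (auto simp: dist_norm cmod_def real_sqrt_eq_iff power2_commute real_sqrt_unique)

lemma ball_Complex_iff: "r \<ge> 0 \<Longrightarrow> Complex x y \<in> ball (Complex c d) r \<longleftrightarrow> (x - c) ^ 2 + (y - d) ^ 2 < r ^ 2"
  by (simp add: dist_norm cmod_def power2_commute real_less_lsqrt real_sqrt_less_iff flip: real_sqrt_less_iff[of _ "r\<^sup>2"])

lemma admissible_side_iff_coord:
  assumes "r \<ge> 0"
  shows "admissible_side r s \<longleftrightarrow> coord_admissible r s"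
proof -
  have sqrt: "(\<exists>w. 0 \<le> w \<and> w ^ 2 = r \<and> Q w) \<longleftrightarrow> Q (sqrt r)" for Q
    using assms by (metis real_sqrt_ge_0_iff real_sqrt_pow2 real_sqrt_unique)
  have div: "y \<le> 2 * r / (r + 1) \<longleftrightarrow> y * (r + 1) \<le> 2 * r" for y
    using assms by (simp add: pos_le_divide_eq)
  have region: "Complex x y \<in> - region r \<longleftrightarrow> \<not> coord_region (sqrt r) r x y" for x y
    using assms by (auto simp: region_def coord_region_def center1_def center2_def ball_Complex_iff div not_less
        simp del: mem_ball)
  have subset: "A \<subseteq> B \<longleftrightarrow> \<not> (A \<inter> - B \<noteq> {})" for A B :: "complex set" by blast
  have c1: "Complex x y \<in> circle1 \<longleftrightarrow> x ^ 2 + (y - 1) ^ 2 = 1" for x y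
    by (simp add: circle1_def center1_def sphere_Complex_iff del: mem_sphere)
  have c2: "Complex x y \<in> circle2 r \<longleftrightarrow> (x - 2 * sqrt r) ^ 2 + (y - r) ^ 2 = r ^ 2" for x y
    using assms by (simp add: circle2_def center2_def sphere_Complex_iff del: mem_sphere)
  have bl: "Complex x y \<in> base_line \<longleftrightarrow> y = 0" for x y by (simp add: base_line_def)
  have nrm: "s = norm (Complex a b) \<longleftrightarrow> 0 \<le> s \<and> s ^ 2 = a ^ 2 + b ^ 2" for a b
    by (auto simp: cmod_def real_sqrt_unique)
  have nz: "Complex a b \<noteq> 0 \<longleftrightarrow> \<not> (a = 0 \<and> b = 0)" for a b by (simp add: complex_eq_iff)
  have ex: "(\<exists>p. Q p) \<longleftrightarrow> (\<exists>x y. Q (Complex x y))" for Q by (metis complex.collapse)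
  show ?thesis
    unfolding admissible_side_def coord_admissible_def sqrt ex subset
      square_meets_iff[OF region] square_meets_iff[OF c1] square_meets_iff[OF c2] square_meets_iff[OF bl] nrm nz
    by (intro ex_cong1) auto
qed

definition coord_least :: "real \<Rightarrow> real \<Rightarrow> bool" where
  "coord_least r s \<longleftrightarrow> coord_admissible r s \<and> (\<forall>s'. coord_admissible r s' \<longrightarrow> s \<le> s')"

lemma coord_least_unique: "coord_least r s \<Longrightarrow> coord_least r s' \<Longrightarrow> s = s'"
  by (meson coord_least_def order.antisym)

lemma sign_definable_coord_least:
  "sign_definable (\<lambda>h::'a::idom \<Rightarrow> real. coord_least (h a ^ n) (h b))"
  unfolding coord_least_def coord_admissible_def square_point_def coord_region_def
  by (intro definable)

text \<open>
  If there is no least side length, then \<open>mu r\<close> is the value of a description that nothing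
  satisfies. This value is the same for all such \<open>r\<close>, so that one more linear factor takes care of it.
\<close>

lemma mu_cases:
  assumes "r \<ge> 0"
  shows "coord_least r (mu r) \<or> mu r = (THE s. False)"
proof (cases "\<exists>s. coord_least r s")
  case True
  then obtain s where s: "coord_least r s" by blast
  then have "mu r = s"
    unfolding mu_def coord_least_def by (intro Least_equality) (auto simp: admissible_side_iff_coord assms)
  with s show ?thesis by simp
next
  case False
  have "mu r = (THE s. coord_least r s)"
    unfolding mu_def Least_def coord_least_def admissible_side_iff_coord[OF assms] ..
  also have "coord_least r = (\<lambda>s. False)" using False by auto
  finally show ?thesis by simp
qed

theorem proposition2p1:
  "algebraic_on {1..} (\<lambda>k. (mu (k\<^sup>2))\<^sup>2) \<and> algebraic_on {1..} mu"
proof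
  show "algebraic_on {1..} mu"
  proof (rule algebraic_on_if_definable[where \<Gamma> = coord_least])
    show "sign_definable (\<lambda>h::real poly poly \<Rightarrow> real. coord_least (h [:[:0, 1:]:]) (h [:0, 1:]))"
      using sign_definable_coord_least[of _ 1] by simp
    show "coord_least x (mu x) \<or> mu x = (THE s. False)" if "x \<in> {1..}" for x
      using mu_cases[of x] that by auto
  qed (rule coord_least_unique)
  show "algebraic_on {1..} (\<lambda>k. (mu (k\<^sup>2))\<^sup>2)"
  proof (rule algebraic_on_if_definable[where \<Gamma> = "\<lambda>k l. \<exists>s. l = s\<^sup>2 \<and> coord_least (k\<^sup>2) s"])
    show "sign_definable (\<lambda>h::real poly poly \<Rightarrow> real.
        \<exists>s. h [:0, 1:] = s\<^sup>2 \<and> coord_least ((h [:[:0, 1:]:])\<^sup>2) s)"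
      by (intro definable sign_definable_coord_least)
    show "(\<exists>s. (mu (k\<^sup>2))\<^sup>2 = s\<^sup>2 \<and> coord_least (k\<^sup>2) s) \<or> (mu (k\<^sup>2))\<^sup>2 = (THE s. False)\<^sup>2" for k
      using mu_cases[of "k\<^sup>2"] by auto
  qed (use coord_least_unique in blast)
qed

end
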